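(* For every integer $n\ge 2$ and every tangential quadrilateral $Q$, there exists an $n\times n$ grid dissection of $Q$ into $n^2$ smaller quadrilaterals, each of which is tangential.
   Context: A convex quadrilateral is tangential if it has an inscribed circle tangent to all four sides; equivalently (Pitot–Steiner), the sums of the lengths of the two pairs of opposite sides are equal. Let $ABCD$ be a convex quadrilateral and $m,n$ positive integers. An $m\times n$ grid dissection of $ABCD$ is given by two families of segments $\mathcal S=\{s_1,\dots,s_{m-1}\}$ and $\mathcal T=\{t_1,\dots,t_{n-1}\}$ such that: each $s\in\mathcal S$ has one endpoint on side $AB$ and the other on side $CD$; each $t\in\mathcal T$ has one endpoint on side $AD$ and the other on side $BC$; the segments of $\mathcal S$ are pairwise disjoint, and the segments of $\mathcal T$ are pairwise disjoint. These segments cut $ABCD$ into $mn$ quadrilaterals. *)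

theory Defs
  imports "HOL-Analysis.Analysis"
begin

type_synonym point = "real^2"

definition orient :: "point \<Rightarrow> point \<Rightarrow> point \<Rightarrow> real" where
  "orient a b c = (b$1 - a$1) * (c$2 - a$2) - (b$2 - a$2) * (c$1 - a$1)"

definition convex_quad :: "point \<Rightarrow> point \<Rightarrow> point \<Rightarrow> point \<Rightarrow> bool" where
  "convex_quad A B C D \<longleftrightarrow>
     (orient A B C > 0 \<and> orient B C D > 0 \<and> orient C D A > 0 \<and> orient D A B > 0) \<or>
     (orient A B C < 0 \<and> orient B C D < 0 \<and> orient C D A < 0 \<and> orient D A B < 0)"

definition tangential :: "point \<Rightarrow> point \<Rightarrow> point \<Rightarrow> point \<Rightarrow> bool" where
  "tangential A B C D \<longleftrightarrow> convex_quad A B C D \<and>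
     (\<exists>Z r. r > 0 \<and> cball Z r \<subseteq> convex hull {A, B, C, D} \<and>
        (\<exists>p\<in>closed_segment A B. dist Z p = r) \<and>
        (\<exists>p\<in>closed_segment B C. dist Z p = r) \<and>
        (\<exists>p\<in>closed_segment C D. dist Z p = r) \<and>
        (\<exists>p\<in>closed_segment D A. dist Z p = r))"

text \<open>An m x n grid dissection of ABCD.  The segments of S are
  s_i = [P i, R i] (0 < i < m), with P i on AB and R i on CD; the segments of T are
  t_j = [U j, V j] (0 < j < n), with U j on AD and V j on BC.  By convention the sides
  AD and BC play the role of s_0 and s_m, and AB, DC the role of t_0 and t_n.  The
  segments are indexed in their order along AB (resp. AD).\<close>
definition grid_dissection ::
  "point \<Rightarrow> point \<Rightarrow> point \<Rightarrow> point \<Rightarrow> nat \<Rightarrow> nat \<Rightarrow>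
   (nat \<Rightarrow> point) \<Rightarrow> (nat \<Rightarrow> point) \<Rightarrow> (nat \<Rightarrow> point) \<Rightarrow> (nat \<Rightarrow> point) \<Rightarrow> bool" where
  "grid_dissection A B C D m n P R U V \<longleftrightarrow>
     P 0 = A \<and> R 0 = D \<and> P m = B \<and> R m = C \<and>
     U 0 = A \<and> V 0 = B \<and> U n = D \<and> V n = C \<and>
     (\<forall>i. 0 < i \<and> i < m \<longrightarrow> P i \<in> closed_segment A B \<and> R i \<in> closed_segment C D) \<and>
     (\<forall>j. 0 < j \<and> j < n \<longrightarrow> U j \<in> closed_segment A D \<and> V j \<in> closed_segment B C) \<and>
     (\<forall>i i'. 0 < i \<and> i < i' \<and> i' < m \<longrightarrow>
         closed_segment (P i) (R i) \<inter> closed_segment (P i') (R i') = {}) \<and>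
     (\<forall>j j'. 0 < j \<and> j < j' \<and> j' < n \<longrightarrow>
         closed_segment (U j) (V j) \<inter> closed_segment (U j') (V j') = {}) \<and>
     (\<forall>i i'. i < i' \<and> i' \<le> m \<longrightarrow> dist A (P i) < dist A (P i')) \<and>
     (\<forall>j j'. j < j' \<and> j' \<le> n \<longrightarrow> dist A (U j) < dist A (U j'))"

definition grid_vertex ::
  "(nat \<Rightarrow> point) \<Rightarrow> (nat \<Rightarrow> point) \<Rightarrow> (nat \<Rightarrow> point) \<Rightarrow> (nat \<Rightarrow> point) \<Rightarrow> nat \<Rightarrow> nat \<Rightarrow> point" where
  "grid_vertex P R U V i j = (THE x. x \<in> closed_segment (P i) (R i) \<inter> closed_segment (U j) (V j))"

end

theory Submission
  imports Defs
begin

text \<open>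
  Let the opposite sides AD, BC meet in E and AB, CD in F (possibly at infinity), and let G be an
  affine function vanishing on the line EF.  Draw all segments of one family through E and all of
  the other through F.  The projective map sending EF to infinity turns Q into the unit square and
  these segments into lines parallel to its sides.  Write u, v for the gradients of the affine functions
  vanishing on AD, AB and equal to G on BC, CD, and w for the gradient of G.  Equating the
  distances of a point to the four sides shows that the cell [a, a'] x [b, b'] is tangential if
  a' - a = k (|u - a w| + |u - a' w|) and b' - b = k (|v - b w| + |v - b' w|) for a common k > 0.
  Subdividing [0, 1] into n such steps fixes k, and solving t' = |u - t w| by hyperbolic functions
  shows that k depends only on n, |w| and |u| + |u - w|.  As Q itself is
  tangential, |u| + |u - w| = |v| + |v - w|, so both families get the same k.
  (If E and F are finite points, the two subdivisions are geometric progressions in the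
  half-angle tangents at E and F.)
\<close>

section \<open>Subdividing a pencil of lines\<close>

text \<open>Sum-to-product formulas sharing one factor: at equally spaced arguments, each increment
  of \<open>cosh\<close> or \<open>sinh\<close> is the same multiple of the sum of its derivative's
  two end values.\<close>

lemma cosh_diff_eq_tanh:
  fixes x y :: real
  shows "cosh x - cosh y = tanh ((x - y) / 2) * (sinh x + sinh y)"
    and "sinh x - sinh y = tanh ((x - y) / 2) * (cosh x + cosh y)"
proof -
  define m h where "m = (x + y) / 2" and "h = (x - y) / 2"
  have xy: "x = m + h" "y = m - h" "(x - y) / 2 = h"
    by (auto simp: m_def h_def field_simps)
  have "cosh h \<noteq> 0" by simp
  then show "cosh x - cosh y = tanh ((x - y) / 2) * (sinh x + sinh y)"
    and "sinh x - sinh y = tanh ((x - y) / 2) * (cosh x + cosh y)"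
    unfolding xy(3) unfolding xy(1,2)
    by (simp_all add: tanh_def cosh_add sinh_add cosh_diff sinh_diff field_simps)
qed

text \<open>
  Here p is sampled from the solution of p'' = \<omega>^2 p with boundary values p0 and p1, and t
  from its primitive.
\<close>
lemma pencil_partition_aux:
  fixes \<omega> p0 p1 M :: real
  assumes "0 < \<omega>" "0 < \<theta>" "0 < n" and M: "\<omega> = M * tanh (n * \<theta> / 2)"
    and p: "0 < p0" "0 < p1" "p0 + p1 = M"
  obtains t p :: "nat \<Rightarrow> real" where "t 0 = 0" "t n = 1"
    "\<And>i. i \<le> n \<Longrightarrow> 0 < p i"
    "\<And>i. (p i)\<^sup>2 = \<omega>\<^sup>2 * (t i)\<^sup>2 + (p1\<^sup>2 - p0\<^sup>2 - \<omega>\<^sup>2) * t i + p0\<^sup>2"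
    "\<And>i. t (Suc i) - t i = tanh (\<theta> / 2) / \<omega> * (p i + p (Suc i))"
proof -
  define c s where "c = cosh (n * \<theta>)" and "s = sinh (n * \<theta>)"
  have s: "s > 0" using assms by (simp add: s_def)
  have s2: "s\<^sup>2 = c\<^sup>2 - 1" by (simp add: c_def s_def cosh_square_eq)
  define e where "e = (p1 - p0 * c) / s"
  define p where "p i = p0 * cosh (real i * \<theta>) + e * sinh (real i * \<theta>)" for i
  define t where "t i = (p0 * sinh (real i * \<theta>) + e * (cosh (real i * \<theta>) - 1)) / \<omega>" for i
  have es: "e * s = p1 - p0 * c" using s by (simp add: e_def)
  have pn: "p n = p1" using es by (simp add: p_def flip: c_def s_def)
  \<comment> \<open>The half-angle formula turns the relation between \<open>M\<close> and
    \<open>\<theta>\<close> into the normalisation \<open>t n = 1\<close>.\<close>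
  have "c - 1 = tanh (n * \<theta> / 2) * s"
    using cosh_diff_eq_tanh(1)[of "n * \<theta>" 0] by (simp add: c_def s_def)
  then have c1: "M * (c - 1) = \<omega> * s" using M by simp
  have "(p0 * s + e * (c - 1)) * s = p0 * s\<^sup>2 + (e * s) * (c - 1)"
    by (simp add: power2_eq_square algebra_simps)
  also have "\<dots> = M * (c - 1)"
    unfolding es s2 p(3)[symmetric] by (simp add: power2_eq_square algebra_simps)
  finally have "p0 * s + e * (c - 1) = \<omega>" using s c1 by simp
  then have tn: "t n = 1" using \<open>0 < \<omega>\<close> by (simp add: t_def flip: c_def s_def)
  \<comment> \<open>As cosh^2 - sinh^2 = 1, the squares of \<open>p i\<close> and
    \<open>\<omega> * t i + e\<close> differ by a constant. The linear coefficient is later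
    identified by taking \<open>i = n\<close>.\<close>
  have sq: "(p i)\<^sup>2 = \<omega>\<^sup>2 * (t i)\<^sup>2 + 2 * e * \<omega> * t i + p0\<^sup>2" for i
  proof -
    have 1: "\<omega> * t i = p0 * sinh (real i * \<theta>) + e * (cosh (real i * \<theta>) - 1)"
      using \<open>0 < \<omega>\<close> by (simp add: t_def)
    have 2: "\<omega>\<^sup>2 * (t i)\<^sup>2 + 2 * e * \<omega> * t i = (\<omega> * t i + e)\<^sup>2 - e\<^sup>2"
      by (simp add: power2_eq_square algebra_simps)
    have 3: "\<omega> * t i + e = p0 * sinh (real i * \<theta>) + e * cosh (real i * \<theta>)"
      unfolding 1 by (simp add: algebra_simps)
    have "(p0 * C + e * S)\<^sup>2 = (p0 * S + e * C)\<^sup>2 - e\<^sup>2 + p0\<^sup>2" if "C\<^sup>2 = S\<^sup>2 + 1" for C S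
    proof -
      have "(p0 * C + e * S)\<^sup>2 - (p0 * S + e * C)\<^sup>2 = (p0\<^sup>2 - e\<^sup>2) * (C\<^sup>2 - S\<^sup>2)"
        by (simp add: power2_eq_square algebra_simps)
      then show ?thesis using that by simp
    qed
    from this[OF cosh_square_eq] show ?thesis
      unfolding 2 3 by (simp add: p_def)
  qed
  show thesis
  proof (rule that)
    show "t 0 = 0" by (simp add: t_def)
    show "t n = 1" by (rule tn)
    show "0 < p i" if "i \<le> n" for i
    proof -
      \<comment> \<open>As \<open>e\<close> may be negative, positivity is read off from the
        interpolation formula \<open>p i * s = p0 * sinh ((n - i) * \<theta>) + p1 * sinh (i *
        \<theta>)\<close>.\<close>
      have d: "sinh (real (n - i) * \<theta>) = s * cosh (real i * \<theta>) - c * sinh (real i * \<theta>)"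
        using that by (simp add: of_nat_diff left_diff_distrib sinh_diff c_def s_def)
      have "p i * s = p0 * s * cosh (real i * \<theta>) + (e * s) * sinh (real i * \<theta>)"
        by (simp add: p_def algebra_simps)
      also have "\<dots> = p0 * sinh (real (n - i) * \<theta>) + p1 * sinh (real i * \<theta>)"
        unfolding es d by (simp add: algebra_simps)
      finally have eq: "p i * s = \<dots>" .
      have "0 < p0 * sinh (real (n - i) * \<theta>) + p1 * sinh (real i * \<theta>)"
      proof (cases "i = n")
        case True
        then show ?thesis using p s by (simp add: s_def)
      next
        case False
        then have "0 < sinh (real (n - i) * \<theta>)" "0 \<le> sinh (real i * \<theta>)"
          using that assms by auto
        then show ?thesis using p(1,2) by (intro add_pos_nonneg mult_pos_pos mult_nonneg_nonneg) (auto simp del: of_nat_diff)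
      qed
      then show ?thesis using eq s by (metis zero_less_mult_pos2)
    qed
    have "p1\<^sup>2 - p0\<^sup>2 - \<omega>\<^sup>2 = 2 * e * \<omega>"
      using sq[of n] pn tn by simp
    then show "(p i)\<^sup>2 = \<omega>\<^sup>2 * (t i)\<^sup>2 + (p1\<^sup>2 - p0\<^sup>2 - \<omega>\<^sup>2) * t i + p0\<^sup>2" for i
      using sq by simp
    show "t (Suc i) - t i = tanh (\<theta> / 2) / \<omega> * (p i + p (Suc i))" for i
    proof -
      have h: "(real (Suc i) * \<theta> - real i * \<theta>) / 2 = \<theta> / 2" by (simp add: algebra_simps)
      have "\<omega> * (t (Suc i) - t i) = p0 * (sinh (real (Suc i) * \<theta>) - sinh (real i * \<theta>))
          + e * (cosh (real (Suc i) * \<theta>) - cosh (real i * \<theta>))"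
        using \<open>0 < \<omega>\<close> by (simp add: t_def right_diff_distrib del: of_nat_Suc)
      also have "\<dots> = tanh (\<theta> / 2) * (p i + p (Suc i))"
        unfolding cosh_diff_eq_tanh h by (simp add: p_def algebra_simps del: of_nat_Suc)
      finally show ?thesis using \<open>0 < \<omega>\<close> by (simp add: field_simps)
    qed
  qed
qed

lemma tanh_artanh_real:
  fixes x :: real
  assumes "-1 < x" "x < 1"
  shows "tanh (artanh x) = x"
proof -
  have "exp (- 2 * artanh x) = (1 - x) / (1 + x)"
    using assms by (simp add: artanh_def exp_minus)
  then show ?thesis
    unfolding tanh_real_altdef using assms by (simp only:) (simp add: divide_simps)
qed

text \<open>The square of \<open>norm (u - x *\<^sub>R w)\<close> is a quadratic in \<open>x\<close>
  determined by \<open>norm u\<close>, \<open>norm (u - w)\<close> and \<open>norm w\<close>.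
  Choosing \<open>k\<close> before \<open>u\<close> and \<open>w\<close> lets one constant serve
  both families of segments.\<close>

lemma pencil_partition:
  fixes \<omega> M :: real
  assumes "0 \<le> \<omega>" "\<omega> < M" "0 < n"
  obtains k where "0 < k"
    "\<And>u w :: 'a::real_inner. \<lbrakk>u \<noteq> 0; u \<noteq> w; norm w = \<omega>; norm u + norm (u - w) = M\<rbrakk> \<Longrightarrow>
       \<exists>t :: nat \<Rightarrow> real. t 0 = 0 \<and> t n = 1 \<and> strict_mono_on {..n} t \<and>
         (\<forall>i<n. t (Suc i) - t i = k * (norm (u - t i *\<^sub>R w) + norm (u - t (Suc i) *\<^sub>R w)))"
proof (cases "\<omega> = 0")
  \<comment> \<open>Here \<open>w = 0\<close>, so the two norms in each step add up to
    \<open>M\<close> and equal steps \<open>1 / n\<close> work.\<close>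
  case True
  show thesis
  proof (rule that[of "1 / (n * M)"])
    fix u w :: 'a
    assume *: "u \<noteq> 0" "u \<noteq> w" "norm w = \<omega>" "norm u + norm (u - w) = M"
    show "\<exists>t :: nat \<Rightarrow> real. t 0 = 0 \<and> t n = 1 \<and> strict_mono_on {..n} t \<and>
         (\<forall>i<n. t (Suc i) - t i = 1 / (n * M) * (norm (u - t i *\<^sub>R w) + norm (u - t (Suc i) *\<^sub>R w)))"
      using * assms True
      by (intro exI[of _ "\<lambda>i. real i / real n"])
         (auto simp: field_simps intro!: strict_mono_onI)
  qed (use assms in auto)
next
  case False
  then have \<omega>: "0 < \<omega>" using assms by simp
  \<comment> \<open>Solves \<open>tanh (n * \<theta> / 2) = \<omega> / M\<close>, which is possible
    because \<open>\<omega> < M\<close>.\<close>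
  define \<theta> where "\<theta> = 2 * artanh (\<omega> / M) / n"
  have th: "tanh (n * \<theta> / 2) = \<omega> / M"
    using tanh_artanh_real[OF less_trans[of _ 0]] assms \<omega> by (simp add: \<theta>_def)
  then have "0 < tanh (n * \<theta> / 2)"
    using \<omega> assms by simp
  then have "\<theta> > 0"
    by (simp add: zero_less_mult_iff)
  have M: "\<omega> = M * tanh (n * \<theta> / 2)" using th assms by simp
  show thesis
  proof (rule that[of "tanh (\<theta> / 2) / \<omega>"])
    show "0 < tanh (\<theta> / 2) / \<omega>" using \<open>\<theta> > 0\<close> \<omega> by simp
    fix u w :: 'a
    assume *: "u \<noteq> 0" "u \<noteq> w" "norm w = \<omega>" "norm u + norm (u - w) = M"
    obtain t p :: "nat \<Rightarrow> real" where t: "t 0 = 0" "t n = 1"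
      and p: "\<And>i. i \<le> n \<Longrightarrow> 0 < p i"
      and sq: "\<And>i. (p i)\<^sup>2 = \<omega>\<^sup>2 * (t i)\<^sup>2 + ((norm (u - w))\<^sup>2 - (norm u)\<^sup>2 - \<omega>\<^sup>2) * t i + (norm u)\<^sup>2"
      and step: "\<And>i. t (Suc i) - t i = tanh (\<theta> / 2) / \<omega> * (p i + p (Suc i))"
      using * pencil_partition_aux[OF \<omega> \<open>\<theta> > 0\<close> \<open>0 < n\<close> M, of "norm u" "norm (u - w)"]
      by auto
    \<comment> \<open>Polarisation expresses \<open>u \<bullet> w\<close> through the three norms,
      so the quadratic is the one in \<open>sq\<close>.\<close>
    have np: "(norm (u - t i *\<^sub>R w))\<^sup>2 = (p i)\<^sup>2" for i
      unfolding sq *(3)[symmetric]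
      by (simp add: power2_norm_eq_inner inner_commute algebra_simps) (simp add: power2_eq_square)
    have pn: "norm (u - t i *\<^sub>R w) = p i" if "i \<le> n" for i
      by (rule power2_eq_imp_eq[OF np norm_ge_zero less_imp_le[OF p[OF that]]])
    have "t i < t (Suc i)" if "i < n" for i
    proof -
      have "0 < tanh (\<theta> / 2) / \<omega> * (p i + p (Suc i))"
        using p[of i] p[of "Suc i"] that \<open>\<theta> > 0\<close> \<omega> by simp
      then show ?thesis using step[of i] by simp
    qed
    then have "t i < t j" if "i < j" "j \<le> n" for i j
      using that
    proof (induction j)
      case (Suc j)
      then show ?case by (metis Suc_le_lessD less_Suc_eq less_imp_le less_trans)
    qed simp
    then have "strict_mono_on {..n} t" by (auto intro!: strict_mono_onI)
    then show "\<exists>t :: nat \<Rightarrow> real. t 0 = 0 \<and> t n = 1 \<and> strict_mono_on {..n} t \<and>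
         (\<forall>i<n. t (Suc i) - t i = tanh (\<theta> / 2) / \<omega> * (norm (u - t i *\<^sub>R w) + norm (u - t (Suc i) *\<^sub>R w)))"
      using t step pn by (intro exI[of _ t]) auto
  qed
qed

section \<open>Projective coordinates on a convex quadrilateral\<close>

text \<open>Cauchy-Schwarz at the touching point bounds \<open>N \<bullet> Z\<close> above; the
  ball's extreme point in direction \<open>- N\<close> stays in the half-space, which bounds it
  below.\<close>

lemma touching_halfspace:
  fixes N Z p :: "'a::real_inner"
  assumes "cball Z r \<subseteq> {x. c \<le> N \<bullet> x}" "N \<bullet> p = c" "dist Z p = r"
  shows "N \<bullet> Z = c + r * norm N"
proof (rule antisym)
  have "N \<bullet> (Z - p) \<le> norm N * norm (Z - p)" by (rule norm_cauchy_schwarz)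
  then show "N \<bullet> Z \<le> c + r * norm N"
    using assms by (simp add: inner_diff_right dist_norm mult.commute)
  have "0 \<le> r" using assms(3) by auto
  then have "Z - r *\<^sub>R sgn N \<in> cball Z r"
    by (simp add: dist_norm norm_sgn)
  then have "c \<le> N \<bullet> (Z - r *\<^sub>R sgn N)" using assms(1) by blast
  moreover have "N \<bullet> sgn N = norm N"
    by (cases "N = 0") (simp_all add: sgn_div_norm dot_square_norm power2_eq_square)
  ultimately show "c + r * norm N \<le> N \<bullet> Z"
    by (simp add: inner_diff_right)
qed

lemma foot_on_hyperplane:
  fixes N Z :: "'a::real_inner"
  assumes "N \<noteq> 0" "\<bar>N \<bullet> Z - c\<bar> = r * norm N"
  obtains x where "dist Z x = r" "N \<bullet> x = c"
proof
  define t where "t = (N \<bullet> Z - c) / (norm N)\<^sup>2"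
  have "\<bar>t\<bar> * norm N = r"
    using assms by (simp add: t_def power2_eq_square)
  then show "dist Z (Z - t *\<^sub>R N) = r" by (simp add: dist_norm)
  show "N \<bullet> (Z - t *\<^sub>R N) = c"
    using assms(1) by (simp add: t_def inner_diff_right dot_square_norm)
qed

lemma convex_comb_pos:
  fixes x y t :: real
  assumes "0 < x" "0 < y" "0 \<le> t" "t \<le> 1"
  shows "0 < (1 - t) * x + t * y"
proof (cases "t = 0")
  case False
  then show ?thesis using assms by (intro add_nonneg_pos) auto
qed (use assms in simp)

text \<open>
  The quadrilateral is the image of the unit square under X below, with (0, 0) going to A.
  In the affine coordinates u, v based at A, the line G = 0 is the one sent to infinity, and
  the point X a b is characterised by u = a G, v = b G.  The assumptions in corners say
  that H = 1 / G is positive at the four corners.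
\<close>
locale projective_square =
  fixes A e1 e2 u v :: point and \<alpha> \<beta> :: real
  assumes dual: "u \<bullet> e1 = 1" "u \<bullet> e2 = 0" "v \<bullet> e1 = 0" "v \<bullet> e2 = 1"
    and expand: "\<And>x. x = (u \<bullet> x) *\<^sub>R e1 + (v \<bullet> x) *\<^sub>R e2"
    and corners: "\<alpha> < 1" "\<beta> < 1" "\<alpha> + \<beta> < 1"
begin

section \<open>The projective map and its coordinate functions\<close>

definition H :: "real \<Rightarrow> real \<Rightarrow> real" where "H a b = 1 - \<alpha> * a - \<beta> * b"

definition X :: "real \<Rightarrow> real \<Rightarrow> point" where
  "X a b = A + (1 / H a b) *\<^sub>R (a *\<^sub>R e1 + b *\<^sub>R e2)"

definition w :: point where "w = \<alpha> *\<^sub>R u + \<beta> *\<^sub>R v"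

definition G :: "point \<Rightarrow> real" where "G x = 1 + w \<bullet> (x - A)"

text \<open>Exchanging the coordinates lets statements about lines of constant \<open>a\<close> be
  reused for lines of constant \<open>b\<close>.\<close>

lemma swap: "projective_square e2 e1 v u \<beta> \<alpha>"
  by unfold_locales (use dual corners expand in \<open>auto simp: add.commute\<close>)

lemma H_pos:
  assumes "a \<in> {0..1}" "b \<in> {0..1}"
  shows "0 < H a b"
proof -
  \<comment> \<open>\<open>H\<close> is affine, hence the bilinear interpolation of its four corner
    values.\<close>
  have "0 < (1 - a) * ((1 - b) * 1 + b * (1 - \<beta>)) + a * ((1 - b) * (1 - \<alpha>) + b * (1 - \<alpha> - \<beta>))"
    using assms corners by (intro convex_comb_pos) auto
  also have "\<dots> = H a b" by (simp add: H_def algebra_simps)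
  finally show ?thesis .
qed

lemma coords_X:
  assumes "0 < H a b"
  shows "u \<bullet> (X a b - A) = a / H a b" "v \<bullet> (X a b - A) = b / H a b" "G (X a b) = 1 / H a b"
proof -
  show 1: "u \<bullet> (X a b - A) = a / H a b" "v \<bullet> (X a b - A) = b / H a b"
    by (simp_all add: X_def inner_add_right dual)
  show "G (X a b) = 1 / H a b"
    unfolding G_def w_def inner_add_left inner_scaleR_left 1
    using assms by (simp add: field_simps) (simp add: H_def algebra_simps)
qed

lemma X_eqI:
  assumes "0 < G x" "u \<bullet> (x - A) = a * G x" "v \<bullet> (x - A) = b * G x"
  shows "x = X a b"
proof -
  \<comment> \<open>Inserting both coordinates into the affine formula for \<open>G\<close> leaves
    an equation solved only by \<open>1 / H a b\<close>; this is the origin of the denominator in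
    \<open>X\<close>.\<close>
  have "G x = 1 + \<alpha> * (a * G x) + \<beta> * (b * G x)"
    unfolding assms(2,3)[symmetric] by (simp add: G_def w_def inner_add_left)
  then have "G x * H a b = 1"
    by (simp add: H_def algebra_simps)
  then have "G x = 1 / H a b" by (metis nonzero_eq_divide_eq mult_zero_right zero_neq_one)
  moreover have "x - A = G x *\<^sub>R (a *\<^sub>R e1 + b *\<^sub>R e2)"
    using expand[of "x - A"] assms(2,3) by (simp add: scaleR_add_right mult.commute)
  ultimately show ?thesis unfolding X_def by (metis add.commute diff_add_cancel)
qed

lemma G_convex_comb: "G ((1 - t) *\<^sub>R x + t *\<^sub>R y) = (1 - t) * G x + t * G y"
  by (simp add: G_def algebra_simps)

section \<open>Grid lines as segments: incidence, intersection and order\<close>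

lemma X_in_segment:
  assumes "0 \<le> a1" "a1 \<le> a" "a \<le> a2" "a2 \<le> 1" "b \<in> {0..1}"
  shows "X a b \<in> closed_segment (X a1 b) (X a2 b)"
proof (cases "a1 = a2")
  case False
  then have less: "a1 < a2" using assms by simp
  have H: "0 < H a b" "0 < H a1 b" "0 < H a2 b" using assms by (auto intro!: H_pos)
  \<comment> \<open>The end points get weights proportional to \<open>(a2 - a) * H a1 b\<close> and
    \<open>(a - a1) * H a2 b\<close>, whose sum is \<open>(a2 - a1) * H a b\<close> because
    \<open>H\<close> is affine in \<open>a\<close>.\<close>
  define t where "t = (a - a1) * H a2 b / ((a2 - a1) * H a b)"
  have "(a2 - a1) * H a b = (a2 - a) * H a1 b + (a - a1) * H a2 b"
    by (simp add: H_def algebra_simps)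
  then have t': "1 - t = (a2 - a) * H a1 b / ((a2 - a1) * H a b)"
    using less H by (simp add: t_def field_simps)
  have t2: "t / H a2 b = (a - a1) / ((a2 - a1) * H a b)"
    using H by (simp add: t_def)
  have t1: "(1 - t) / H a1 b = (a2 - a) / ((a2 - a1) * H a b)"
    using H by (simp add: t')
  have "0 \<le> t" using less H assms by (simp add: t_def)
  have "0 \<le> 1 - t" using less H assms unfolding t' by simp
  define y where "y = (1 - t) *\<^sub>R X a1 b + t *\<^sub>R X a2 b"
  have yA: "y - A = (1 - t) *\<^sub>R (X a1 b - A) + t *\<^sub>R (X a2 b - A)"
    by (simp add: y_def algebra_simps)
  have sum: "(1 - t) / H a1 b + t / H a2 b = 1 / H a b"
    unfolding t1 t2 add_divide_distrib[symmetric] using less by simp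
  have sum': "(1 - t) * (a1 / H a1 b) + t * (a2 / H a2 b) = a / H a b"
  proof -
    have "(1 - t) * (a1 / H a1 b) + t * (a2 / H a2 b) = a1 * ((1 - t) / H a1 b) + a2 * (t / H a2 b)"
      by (simp add: mult.commute)
    also have "\<dots> = (a1 * (a2 - a) + a2 * (a - a1)) / ((a2 - a1) * H a b)"
      unfolding t1 t2 by (simp add: add_divide_distrib)
    also have "a1 * (a2 - a) + a2 * (a - a1) = (a2 - a1) * a" by (simp add: algebra_simps)
    finally show ?thesis using less by simp
  qed
  have Gy: "G y = 1 / H a b"
    unfolding y_def G_convex_comb using H sum by (simp add: coords_X)
  have "y = X a b"
  proof (rule X_eqI)
    show "0 < G y" using Gy H by simp
    show "u \<bullet> (y - A) = a * G y"
      unfolding Gy yA inner_add_right inner_scaleR_right using H sum' by (simp add: coords_X)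
    have "v \<bullet> (y - A) = (1 - t) * (b / H a1 b) + t * (b / H a2 b)"
      unfolding yA inner_add_right inner_scaleR_right using H by (simp add: coords_X)
    also have "\<dots> = b * ((1 - t) / H a1 b + t / H a2 b)" by (simp add: algebra_simps)
    finally show "v \<bullet> (y - A) = b * G y" unfolding sum Gy .
  qed
  then show ?thesis
    using \<open>0 \<le> t\<close> \<open>0 \<le> 1 - t\<close> unfolding closed_segment_def y_def by (auto intro!: exI[of _ t])
qed (use assms in auto)

lemma X_in_segment':
  assumes "0 \<le> b1" "b1 \<le> b" "b \<le> b2" "b2 \<le> 1" "a \<in> {0..1}"
  shows "X a b \<in> closed_segment (X a b1) (X a b2)"
proof -
  interpret sw: projective_square A e2 e1 v u \<beta> \<alpha> by (rule swap)
  have "sw.X b a = X a b" for a b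
    by (simp add: sw.X_def X_def sw.H_def H_def algebra_simps)
  then show ?thesis using sw.X_in_segment[OF assms] by simp
qed

text \<open>Both \<open>G x\<close> and \<open>u \<bullet> (x - A) - a * G x\<close> are affine in
  \<open>x\<close>; at the two end points the first is positive and the second zero.\<close>

lemma in_segment_X:
  assumes "x \<in> closed_segment (X a b1) (X a b2)" "a \<in> {0..1}" "b1 \<in> {0..1}" "b2 \<in> {0..1}"
  shows "0 < G x" "u \<bullet> (x - A) = a * G x"
proof -
  obtain t where t: "0 \<le> t" "t \<le> 1" "x = (1 - t) *\<^sub>R X a b1 + t *\<^sub>R X a b2"
    using assms(1) by (auto simp: closed_segment_def)
  have H: "0 < H a b1" "0 < H a b2" using assms by (auto intro!: H_pos)
  show "0 < G x"
    unfolding t(3) G_convex_comb using H t by (intro convex_comb_pos) (auto simp: coords_X)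
  have "x - A = (1 - t) *\<^sub>R (X a b1 - A) + t *\<^sub>R (X a b2 - A)"
    unfolding t(3) by (simp add: algebra_simps)
  then have "u \<bullet> (x - A) = (1 - t) * (a * G (X a b1)) + t * (a * G (X a b2))"
    using H by (simp add: inner_add_right coords_X)
  then show "u \<bullet> (x - A) = a * G x"
    unfolding t(3) G_convex_comb by (simp add: algebra_simps)
qed

lemma in_segment_X':
  assumes "x \<in> closed_segment (X a1 b) (X a2 b)" "b \<in> {0..1}" "a1 \<in> {0..1}" "a2 \<in> {0..1}"
  shows "v \<bullet> (x - A) = b * G x"
proof -
  interpret sw: projective_square A e2 e1 v u \<beta> \<alpha> by (rule swap)
  have "sw.X b a = X a b" "sw.G x = G x" for a b x
    by (simp_all add: sw.X_def X_def sw.H_def H_def sw.G_def G_def sw.w_def w_def algebra_simps)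
  then show ?thesis using sw.in_segment_X(2)[of x b a1 a2] assms by simp
qed

lemma segment_Int_segment:
  assumes "a \<in> {0..1}" "b \<in> {0..1}"
  shows "closed_segment (X a 0) (X a 1) \<inter> closed_segment (X 0 b) (X 1 b) = {X a b}"
proof (intro equalityI subsetI)
  fix x assume "x \<in> closed_segment (X a 0) (X a 1) \<inter> closed_segment (X 0 b) (X 1 b)"
  then have "x = X a b"
    using assms in_segment_X[of x a 0 1] in_segment_X'[of x 0 b 1] by (intro X_eqI) auto
  then show "x \<in> {X a b}" by simp
next
  fix x assume "x \<in> {X a b}"
  then show "x \<in> closed_segment (X a 0) (X a 1) \<inter> closed_segment (X 0 b) (X 1 b)"
    using X_in_segment[of 0 a 1 b] X_in_segment'[of 0 b 1 a] assms by auto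
qed

lemma segments_disjoint:
  assumes "a < a'" "a \<in> {0..1}" "a' \<in> {0..1}"
  shows "closed_segment (X a 0) (X a 1) \<inter> closed_segment (X a' 0) (X a' 1) = {}"
proof -
  have False if "x \<in> closed_segment (X a 0) (X a 1)" "x \<in> closed_segment (X a' 0) (X a' 1)" for x
    using that assms in_segment_X[of x a 0 1] in_segment_X[of x a' 0 1] by auto
  then show ?thesis by blast
qed

lemma dist_X_less:
  assumes "a < a'" "a \<in> {0..1}" "a' \<in> {0..1}"
  shows "dist A (X a 0) < dist A (X a' 0)"
proof -
  have H: "0 < H a 0" "0 < H a' 0" using assms by (auto intro!: H_pos)
  have "dist A (X a 0) = a / H a 0 * norm e1" if "a \<in> {0..1}" for a
    using that H_pos[of a 0] by (simp add: X_def dist_norm)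
  moreover have "e1 \<noteq> 0" using dual by auto
  moreover have "a / H a 0 < a' / H a' 0"
    using H assms by (simp add: field_simps) (simp add: H_def algebra_simps)
  ultimately show ?thesis using assms by (simp del: times_divide_eq_left)
qed

section \<open>Normals, orientation and convexity of the cells\<close>

lemma normal_nonzero:
  assumes "a \<in> {0..1}"
  shows "u - a *\<^sub>R w \<noteq> 0"
proof -
  \<comment> \<open>This vector is the gradient of \<open>u \<bullet> (x - A) - a * G x\<close>,
    hence a normal of the grid line with first coordinate \<open>a\<close>.\<close>
  have "(u - a *\<^sub>R w) \<bullet> e1 = H a 0"
    by (simp add: w_def H_def inner_diff_left inner_add_left dual)
  then show ?thesis using H_pos[of a 0] assms by auto
qed

text \<open>A projective map scales signed area by a fixed determinant over the product of the
  denominators, so where \<open>H\<close> is positive it keeps all orientations up to one global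
  sign.\<close>

lemma orient_X:
  assumes "0 < H a1 b1" "0 < H a2 b2" "0 < H a3 b3"
  shows "orient (X a1 b1) (X a2 b2) (X a3 b3) =
    (e1$1 * e2$2 - e1$2 * e2$1) * ((a2 - a1) * (b3 - b1) - (b2 - b1) * (a3 - a1))
      / (H a1 b1 * H a2 b2 * H a3 b3)"
proof -
  have X: "X a b $ i = A $ i + (a / H a b) * e1 $ i + (b / H a b) * e2 $ i" for a b i
    by (simp add: X_def add_divide_distrib algebra_simps)
  have 1: "orient (X a1 b1) (X a2 b2) (X a3 b3) = (e1$1 * e2$2 - e1$2 * e2$1) *
      ((a2 / H a2 b2 - a1 / H a1 b1) * (b3 / H a3 b3 - b1 / H a1 b1)
       - (b2 / H a2 b2 - b1 / H a1 b1) * (a3 / H a3 b3 - a1 / H a1 b1))"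
    unfolding orient_def X by algebra
  have 2: "(a2 / h2 - a1 / h1) * (b3 / h3 - b1 / h1) - (b2 / h2 - b1 / h1) * (a3 / h3 - a1 / h1)
    = (h1 * (a2 * b3 - a3 * b2) - h2 * (a1 * b3 - a3 * b1) + h3 * (a1 * b2 - a2 * b1)) / (h1 * h2 * h3)"
    if "0 < h1" "0 < h2" "0 < h3" for h1 h2 h3 :: real
    using that by (simp add: divide_simps) (simp add: algebra_simps)
  \<comment> \<open>The left side is the determinant with rows \<open>(H a b, a, b)\<close>; column
    operations turn the first column into ones.\<close>
  have 3: "H a1 b1 * (a2 * b3 - a3 * b2) - H a2 b2 * (a1 * b3 - a3 * b1) + H a3 b3 * (a1 * b2 - a2 * b1)
    = (a2 - a1) * (b3 - b1) - (b2 - b1) * (a3 - a1)"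
    unfolding H_def by algebra
  show ?thesis unfolding 1 2[OF assms] 3 by simp
qed

lemma det_nonzero: "e1$1 * e2$2 - e1$2 * e2$1 \<noteq> 0"
proof -
  have "(u$1 * v$2 - u$2 * v$1) * (e1$1 * e2$2 - e1$2 * e2$1) = (u \<bullet> e1) * (v \<bullet> e2) - (u \<bullet> e2) * (v \<bullet> e1)"
    by (simp add: inner_vec_def sum_2) algebra
  then show ?thesis using dual by auto
qed

lemma convex_quad_cell:
  assumes "0 \<le> a1" "a1 < a2" "a2 \<le> 1" "0 \<le> b1" "b1 < b2" "b2 \<le> 1"
  shows "convex_quad (X a1 b1) (X a2 b1) (X a2 b2) (X a1 b2)"
proof -
  have H: "0 < H a1 b1" "0 < H a2 b1" "0 < H a2 b2" "0 < H a1 b2"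
    using assms by (auto intro!: H_pos)
  have pos: "0 < (a2 - a1) * (b2 - b1)" using assms by simp
  define d where "d = e1$1 * e2$2 - e1$2 * e2$1"
  have "d > 0 \<or> d < 0" using det_nonzero by (auto simp: d_def)
  then show ?thesis
    unfolding convex_quad_def using H pos
    by (simp add: orient_X flip: d_def)
       (auto simp: zero_less_divide_iff divide_less_0_iff zero_less_mult_iff mult_less_0_iff)
qed

section \<open>Inscribed circles of the cells\<close>

lemma cell_memberE:
  assumes "a1 < a2" "b1 < b2"
    "a1 * G x \<le> u \<bullet> (x - A)" "u \<bullet> (x - A) \<le> a2 * G x"
    "b1 * G x \<le> v \<bullet> (x - A)" "v \<bullet> (x - A) \<le> b2 * G x"
  obtains a b where "x = X a b" "a \<in> {a1..a2}" "b \<in> {b1..b2}"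
    "u \<bullet> (x - A) = a * G x" "v \<bullet> (x - A) = b * G x" "0 < G x"
proof -
  \<comment> \<open>Subtracting the bounds on \<open>u\<close> gives \<open>G x\<close> nonnegative;
    if it vanished, both coordinates would be 0 and hence \<open>G x = 1\<close>.\<close>
  have "0 \<le> (a2 - a1) * G x" using assms by (simp add: algebra_simps)
  then have "0 \<le> G x" using assms(1) by (simp add: zero_le_mult_iff)
  moreover have "G x \<noteq> 0"
  proof
    assume "G x = 0"
    with assms have "u \<bullet> (x - A) = 0" "v \<bullet> (x - A) = 0" by auto
    then have "G x = 1" by (simp add: G_def w_def inner_add_left)
    with \<open>G x = 0\<close> show False by simp
  qed
  ultimately have G: "0 < G x" by simp
  show thesis
    by (rule that[of "u \<bullet> (x - A) / G x" "v \<bullet> (x - A) / G x"])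
       (use G assms in \<open>auto simp: field_simps intro!: X_eqI\<close>)
qed

lemma X_in_cell:
  assumes "a \<in> {a1..a2}" "b \<in> {b1..b2}" "0 \<le> a1" "a2 \<le> 1" "0 \<le> b1" "b2 \<le> 1"
  shows "X a b \<in> convex hull {X a1 b1, X a2 b1, X a2 b2, X a1 b2}" (is "_ \<in> ?K")
proof -
  have seg: "closed_segment x y \<subseteq> ?K" if "x \<in> ?K" "y \<in> ?K" for x y
    using that by (simp add: closed_segment_subset)
  have "X a b1 \<in> ?K" "X a b2 \<in> ?K"
    using X_in_segment[of a1 a a2 b1] X_in_segment[of a1 a a2 b2] assms
      seg[of "X a1 b1" "X a2 b1"] seg[of "X a1 b2" "X a2 b2"]
    by (auto simp: hull_inc)
  then show ?thesis
    using X_in_segment'[of b1 b b2 a] seg[of "X a b1" "X a b2"] assms by auto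
qed

lemma tangential_cell:
  assumes a: "0 \<le> a1" "a1 < a2" "a2 \<le> 1" and b: "0 \<le> b1" "b1 < b2" "b2 \<le> 1" and "0 < k"
    and ka: "a2 - a1 = k * (norm (u - a1 *\<^sub>R w) + norm (u - a2 *\<^sub>R w))"
    and kb: "b2 - b1 = k * (norm (v - b1 *\<^sub>R w) + norm (v - b2 *\<^sub>R w))"
  shows "tangential (X a1 b1) (X a2 b1) (X a2 b2) (X a1 b2)"
proof -
  interpret sw: projective_square A e2 e1 v u \<beta> \<alpha> by (rule swap)
  have sw_w: "sw.w = w" by (simp add: sw.w_def w_def add.commute)
  \<comment> \<open>The incentre is X m l: there u - a1 G = k |u - a1 w| G, so its distance to this side is
    r = k G, and likewise for the other three sides.\<close>
  define m l where "m = a1 + k * norm (u - a1 *\<^sub>R w)" and "l = b1 + k * norm (v - b1 *\<^sub>R w)"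
  \<comment> \<open>By \<open>ka\<close> and \<open>kb\<close>, measuring from the opposite sides
    leads to the same point.\<close>
  have m2: "m = a2 - k * norm (u - a2 *\<^sub>R w)" and l2: "l = b2 - k * norm (v - b2 *\<^sub>R w)"
    using ka kb by (simp_all add: m_def l_def algebra_simps)
  have ml: "m \<in> {a1..a2}" "l \<in> {b1..b2}"
    using \<open>0 < k\<close> by (auto simp: m_def l_def) (auto simp: m2 l2 simp flip: m_def l_def)
  define Z where "Z = X m l"
  have "0 < H m l" using ml a b by (auto intro!: H_pos)
  then have Z: "0 < G Z" "u \<bullet> (Z - A) = m * G Z" "v \<bullet> (Z - A) = l * G Z"
    by (simp_all add: Z_def coords_X)
  define r where "r = k * G Z"
  have "0 < r" using Z \<open>0 < k\<close> by (simp add: r_def)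
  \<comment> \<open>Rewrites a grid line as a hyperplane with normal
    \<open>N - c *\<^sub>R w\<close>, the form suited to distances.\<close>
  have lin: "N \<bullet> (x - A) - c * G x = (N - c *\<^sub>R w) \<bullet> x - (c + (N - c *\<^sub>R w) \<bullet> A)" for N x :: point and c :: real
    by (simp add: G_def algebra_simps)
  have centre:
    "(u - a1 *\<^sub>R w) \<bullet> Z - (a1 + (u - a1 *\<^sub>R w) \<bullet> A) = r * norm (u - a1 *\<^sub>R w)"
    "(u - a2 *\<^sub>R w) \<bullet> Z - (a2 + (u - a2 *\<^sub>R w) \<bullet> A) = - (r * norm (u - a2 *\<^sub>R w))"
    "(v - b1 *\<^sub>R w) \<bullet> Z - (b1 + (v - b1 *\<^sub>R w) \<bullet> A) = r * norm (v - b1 *\<^sub>R w)"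
    "(v - b2 *\<^sub>R w) \<bullet> Z - (b2 + (v - b2 *\<^sub>R w) \<bullet> A) = - (r * norm (v - b2 *\<^sub>R w))"
    unfolding lin[symmetric] Z r_def
    by (simp add: m_def algebra_simps, simp add: m2 algebra_simps,
        simp add: l_def algebra_simps, simp add: l2 algebra_simps)
  have cs: "\<bar>N \<bullet> x - N \<bullet> Z\<bar> \<le> r * norm N" if "dist Z x \<le> r" for N x
  proof -
    have "\<bar>N \<bullet> (x - Z)\<bar> \<le> norm N * norm (x - Z)" by (rule Cauchy_Schwarz_ineq2)
    also have "\<dots> \<le> norm N * r"
      using that by (intro mult_left_mono) (auto simp: dist_norm norm_minus_commute)
    finally show ?thesis by (simp add: inner_diff_right mult.commute)
  qed
  \<comment> \<open>Moving from \<open>Z\<close> by at most \<open>r\<close> changes each of the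
    four side functions by at most its absolute value at \<open>Z\<close>, so the closed disc stays
    in the cell.\<close>
  have cell: "\<exists>a b. x = X a b \<and> a \<in> {a1..a2} \<and> b \<in> {b1..b2} \<and>
      u \<bullet> (x - A) = a * G x \<and> v \<bullet> (x - A) = b * G x \<and> 0 < G x" if x: "dist Z x \<le> r" for x
  proof -
    have "a1 * G x \<le> u \<bullet> (x - A)" "u \<bullet> (x - A) \<le> a2 * G x"
      "b1 * G x \<le> v \<bullet> (x - A)" "v \<bullet> (x - A) \<le> b2 * G x"
      using centre lin[of u x a1] lin[of u x a2] lin[of v x b1] lin[of v x b2]
        cs[OF x, of "u - a1 *\<^sub>R w"] cs[OF x, of "u - a2 *\<^sub>R w"]
        cs[OF x, of "v - b1 *\<^sub>R w"] cs[OF x, of "v - b2 *\<^sub>R w"]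
      by linarith+
    from cell_memberE[OF a(2) b(2) this] show ?thesis by metis
  qed
  have touch: "\<exists>x. dist Z x = r \<and> N \<bullet> (x - A) = c * G x"
    if "N - c *\<^sub>R w \<noteq> 0"
      "\<bar>(N - c *\<^sub>R w) \<bullet> Z - (c + (N - c *\<^sub>R w) \<bullet> A)\<bar> = r * norm (N - c *\<^sub>R w)" for N :: point and c :: real
  proof -
    from foot_on_hyperplane[OF that] obtain x
      where x: "dist Z x = r" "(N - c *\<^sub>R w) \<bullet> x = c + (N - c *\<^sub>R w) \<bullet> A" .
    then show ?thesis using lin[of N x c] by auto
  qed
  have touch_a: "\<exists>x\<in>closed_segment (X c b1) (X c b2). dist Z x = r"
    if c: "c \<in> {0..1}" and Nc: "\<bar>(u - c *\<^sub>R w) \<bullet> Z - (c + (u - c *\<^sub>R w) \<bullet> A)\<bar> = r * norm (u - c *\<^sub>R w)" for c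
  proof -
    obtain x where x: "dist Z x = r" "u \<bullet> (x - A) = c * G x"
      using touch[OF normal_nonzero[OF c] Nc] by blast
    \<comment> \<open>The foot of the perpendicular lies in the disc, hence in the cell; so it is on
      the side itself and not merely on the line carrying it.\<close>
    obtain a b' where ab: "x = X a b'" "b' \<in> {b1..b2}" "u \<bullet> (x - A) = a * G x" "0 < G x"
      using cell[OF eq_refl[OF x(1)]] by blast
    have "a = c" using ab(3,4) x(2) by simp
    then have "x \<in> closed_segment (X c b1) (X c b2)"
      using X_in_segment'[of b1 b' b2 c] ab(1,2) c b by simp
    then show ?thesis using x(1) by blast
  qed
  have touch_b: "\<exists>x\<in>closed_segment (X a1 c) (X a2 c). dist Z x = r"
    if c: "c \<in> {0..1}" and Nc: "\<bar>(v - c *\<^sub>R w) \<bullet> Z - (c + (v - c *\<^sub>R w) \<bullet> A)\<bar> = r * norm (v - c *\<^sub>R w)" for c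
  proof -
    obtain x where x: "dist Z x = r" "v \<bullet> (x - A) = c * G x"
      using touch[OF sw.normal_nonzero[unfolded sw_w, OF c] Nc] by blast
    obtain a' b where ab: "x = X a' b" "a' \<in> {a1..a2}" "v \<bullet> (x - A) = b * G x" "0 < G x"
      using cell[OF eq_refl[OF x(1)]] by blast
    have "b = c" using ab(3,4) x(2) by simp
    then have "x \<in> closed_segment (X a1 c) (X a2 c)"
      using X_in_segment[of a1 a' a2 c] ab(1,2) c a by simp
    then show ?thesis using x(1) by blast
  qed
  have "cball Z r \<subseteq> convex hull {X a1 b1, X a2 b1, X a2 b2, X a1 b2}"
  proof
    fix x assume "x \<in> cball Z r"
    then obtain a' b' where "x = X a' b'" "a' \<in> {a1..a2}" "b' \<in> {b1..b2}"
      using cell[of x] by auto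
    then show "x \<in> convex hull {X a1 b1, X a2 b1, X a2 b2, X a1 b2}"
      using X_in_cell a b by simp
  qed
  moreover have
    "\<exists>x\<in>closed_segment (X a1 b1) (X a2 b1). dist Z x = r"
    "\<exists>x\<in>closed_segment (X a1 b2) (X a2 b2). dist Z x = r"
    "\<exists>x\<in>closed_segment (X a1 b1) (X a1 b2). dist Z x = r"
    "\<exists>x\<in>closed_segment (X a2 b1) (X a2 b2). dist Z x = r"
    using a b \<open>0 < r\<close>
    by (intro touch_b touch_a; simp add: centre)+
  ultimately show ?thesis
    unfolding tangential_def
    using convex_quad_cell[OF a b] \<open>0 < r\<close>
    by (metis closed_segment_commute)
qed

text \<open>At the incentre \<open>Z\<close>, the affine functions of one pair of opposite sides
  take the values \<open>r * norm u\<close> and \<open>r * norm (u - w)\<close>, which add up to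
  \<open>G Z\<close>. The other pair has the same total.\<close>

lemma tangential_imp_norm_sum_eq:
  assumes "tangential (X 0 0) (X 1 0) (X 1 1) (X 0 1)"
  shows "norm u + norm (u - w) = norm v + norm (v - w)"
proof -
  let ?V = "{X 0 0, X 1 0, X 1 1, X 0 1}"
  obtain Z r pa pb pc pd where r: "r > 0" and ball: "cball Z r \<subseteq> convex hull ?V"
    and p: "pa \<in> closed_segment (X 0 0) (X 1 0)" "dist Z pa = r"
      "pb \<in> closed_segment (X 1 0) (X 1 1)" "dist Z pb = r"
      "pc \<in> closed_segment (X 0 1) (X 1 1)" "dist Z pc = r"
      "pd \<in> closed_segment (X 0 0) (X 0 1)" "dist Z pd = r"
    using assms unfolding tangential_def by (metis closed_segment_commute)
  have H: "0 < H 0 0" "0 < H 1 0" "0 < H 1 1" "0 < H 0 1" by (auto intro!: H_pos)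
  have G: "G x = 1 + w \<bullet> x - w \<bullet> A" for x by (simp add: G_def inner_diff_right)
  have half: "cball Z r \<subseteq> {x. c \<le> N \<bullet> x}" if "\<forall>y\<in>?V. c \<le> N \<bullet> y" for N :: point and c :: real
  proof -
    have "convex {x. c \<le> N \<bullet> x}" using convex_halfspace_ge[of c N] by simp
    then have "convex hull ?V \<subseteq> {x. c \<le> N \<bullet> x}" using that by (intro hull_minimal) auto
    then show ?thesis using ball by blast
  qed
  have V: "\<forall>y\<in>?V. 0 \<le> u \<bullet> (y - A)" "\<forall>y\<in>?V. u \<bullet> (y - A) \<le> G y"
    "\<forall>y\<in>?V. 0 \<le> v \<bullet> (y - A)" "\<forall>y\<in>?V. v \<bullet> (y - A) \<le> G y"
    using H by (auto simp: coords_X)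
  have "u \<bullet> Z = u \<bullet> A + r * norm u"
    using V(1) in_segment_X(2)[OF p(7)] p(8)
    by (intro touching_halfspace[of _ _ _ _ pd] half) (auto simp: inner_diff_right)
  moreover have "(w - u) \<bullet> Z = (w - u) \<bullet> A - 1 + r * norm (w - u)"
    using V(2) in_segment_X(2)[OF p(3)] p(4)
    by (intro touching_halfspace[of _ _ _ _ pb] half) (auto simp: inner_diff_right inner_diff_left G)
  moreover have "v \<bullet> Z = v \<bullet> A + r * norm v"
    using V(3) in_segment_X'[OF p(1)] p(2)
    by (intro touching_halfspace[of _ _ _ _ pa] half) (auto simp: inner_diff_right)
  moreover have "(w - v) \<bullet> Z = (w - v) \<bullet> A - 1 + r * norm (w - v)"
    using V(4) in_segment_X'[OF p(5)] p(6)
    by (intro touching_halfspace[of _ _ _ _ pc] half) (auto simp: inner_diff_right inner_diff_left G)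
  ultimately have "r * (norm u + norm (u - w)) = r * (norm v + norm (v - w))"
    by (simp add: inner_diff_left algebra_simps norm_minus_commute)
  then show ?thesis using r by simp
qed

text \<open>Equality in the triangle inequality would place \<open>u\<close>, and by the assumption
  also \<open>v\<close>, on the segment from 0 to \<open>w\<close>, making them parallel. The strict
  bound makes \<open>pencil_partition\<close> applicable.\<close>

lemma norm_w_less:
  assumes "norm u + norm (u - w) = norm v + norm (v - w)"
  shows "norm w < norm u + norm (u - w)"
proof (rule ccontr)
  assume "\<not> ?thesis"
  moreover have "norm w \<le> norm u + norm (u - w)"
    using norm_triangle_ineq4[of u "u - w"] by simp
  ultimately have "norm w = norm u + norm (u - w)" by simp
  then have "between (0, w) u" "between (0, w) v"
    using assms by (simp_all add: between dist_norm)
  then obtain s t where st: "u = s *\<^sub>R w" "v = t *\<^sub>R w"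
    by (auto simp: between_mem_segment in_segment)
  have "(u \<bullet> e1) * (v \<bullet> e2) = (s * (w \<bullet> e1)) * (t * (w \<bullet> e2))"
    using st by (metis inner_scaleR_left)
  also have "\<dots> = (s * (w \<bullet> e2)) * (t * (w \<bullet> e1))" by simp
  also have "\<dots> = (u \<bullet> e2) * (v \<bullet> e1)"
    using st by (metis inner_scaleR_left)
  finally show False by (simp add: dual)
qed

end

section \<open>Fitting projective coordinates to a given quadrilateral\<close>

lemma convex_quad_projective_square:
  assumes "convex_quad A B C D"
  obtains e1 e2 u v \<alpha> \<beta> where "projective_square e1 e2 u v \<alpha> \<beta>"
    "projective_square.X A e1 e2 \<alpha> \<beta> 0 0 = A" "projective_square.X A e1 e2 \<alpha> \<beta> 1 0 = B"
    "projective_square.X A e1 e2 \<alpha> \<beta> 1 1 = C" "projective_square.X A e1 e2 \<alpha> \<beta> 0 1 = D"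
proof -
  \<comment> \<open>C = A + l (B - A) + m (D - A), and convexity means l, m > 0 and l + m > 1.\<close>
  define d where "d = orient D A B"
  define l m where "l = orient C D A / d" and "m = orient A B C / d"
  have d: "d \<noteq> 0" using assms by (auto simp: convex_quad_def d_def)
  \<comment> \<open>Triangles \<open>ABC\<close> and \<open>CDA\<close> have the same total signed
    area as \<open>BCD\<close> and \<open>DAB\<close>.\<close>
  have "orient B C D / d = l + m - 1"
    using d by (simp add: l_def m_def field_simps) (simp add: d_def orient_def algebra_simps)
  moreover have "0 < l" "0 < m" "0 < orient B C D / d"
    using assms by (auto simp: convex_quad_def l_def m_def d_def zero_less_divide_iff)
  ultimately have lm: "0 < l" "0 < m" "0 < l + m - 1" by auto
  have C: "C - A = l *\<^sub>R (B - A) + m *\<^sub>R (D - A)"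
  proof -
    have "d * (C$i - A$i) = orient C D A * (B$i - A$i) + orient A B C * (D$i - A$i)"
      if "i = 1 \<or> i = 2" for i :: 2
      using that
    proof
      assume i: "i = 1"
      show ?thesis unfolding d_def orient_def i by algebra
    next
      assume i: "i = 2"
      show ?thesis unfolding d_def orient_def i by algebra
    qed
    then have "C$i - A$i = (orient C D A * (B$i - A$i) + orient A B C * (D$i - A$i)) / d"
      if "i = 1 \<or> i = 2" for i :: 2
      using that d by (metis nonzero_mult_div_cancel_left)
    then have "C$i - A$i = l * (B$i - A$i) + m * (D$i - A$i)" if "i = 1 \<or> i = 2" for i :: 2
      using that by (simp add: l_def m_def add_divide_distrib)
    then show ?thesis by (simp add: vec_eq_iff forall_2)
  qed
  \<comment> \<open>\<open>s\<close> is to be \<open>H 1 1\<close>. The corners \<open>B\<close> and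
    \<open>D\<close> force \<open>e1 = (1 - \<alpha>) *\<^sub>R (B - A)\<close> and
    \<open>e2 = (1 - \<beta>) *\<^sub>R (D - A)\<close>; then \<open>C\<close> forces
    \<open>1 - \<alpha> = l * s\<close> and \<open>1 - \<beta> = m * s\<close>, so
    \<open>l * s + m * s = 1 + s\<close>.\<close>
  define s where "s = 1 / (l + m - 1)"
  have s: "0 < s" "l * s + m * s = 1 + s" using lm by (simp_all add: s_def flip: add_divide_distrib) (simp add: field_simps)
  define e1 e2 where "e1 = (l * s) *\<^sub>R (B - A)" and "e2 = (m * s) *\<^sub>R (D - A)"
  define e where "e = e1$1 * e2$2 - e1$2 * e2$1"
  have "e = (l * s) * (m * s) * d"
    by (simp add: e_def e1_def e2_def d_def orient_def algebra_simps)
  then have e: "e \<noteq> 0" using lm s d by simp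
  \<comment> \<open>The rows of the inverse of the matrix with columns \<open>e1\<close> and
    \<open>e2\<close>.\<close>
  define u v :: point
    where "u = (1 / e) *\<^sub>R vector [e2$2, - e2$1]" and "v = (1 / e) *\<^sub>R vector [- e1$2, e1$1]"
  interpret projective_square A e1 e2 u v "1 - l * s" "1 - m * s"
  proof
    show "u \<bullet> e1 = 1" "u \<bullet> e2 = 0" "v \<bullet> e1 = 0" "v \<bullet> e2 = 1"
      using e by (simp_all add: u_def v_def inner_vec_def sum_2 field_simps)
        (simp_all add: e_def algebra_simps)
    show "x = (u \<bullet> x) *\<^sub>R e1 + (v \<bullet> x) *\<^sub>R e2" for x
      using e by (simp add: u_def v_def inner_vec_def sum_2 vec_eq_iff forall_2 field_simps)
        (simp add: e_def algebra_simps)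
    show "1 - l * s < 1" "1 - m * s < 1" "1 - l * s + (1 - m * s) < 1" using lm s by auto
  qed
  have "H 1 1 = s" using s by (simp add: H_def)
  then have "X 1 1 = A + (l *\<^sub>R (B - A) + m *\<^sub>R (D - A))"
    using s by (simp add: X_def) (simp add: e1_def e2_def scaleR_add_right)
  then have "X 1 1 = C" unfolding C[symmetric] by simp
  moreover have "X 0 0 = A" "X 1 0 = B" "X 0 1 = D"
    using lm s by (simp_all add: X_def H_def) (simp_all add: e1_def e2_def)
  ultimately show thesis using that projective_square_axioms by blast
qed

section \<open>Assembling the grid\<close>

theorem mainTheorem1:
  fixes n :: nat and A B C D :: point
  assumes "n \<ge> 2" and "tangential A B C D"
  shows "\<exists>P R U V. grid_dissection A B C D n n P R U V \<and>
    (\<forall>i\<le>n. \<forall>j\<le>n. \<exists>x. closed_segment (P i) (R i) \<inter> closed_segment (U j) (V j) = {x}) \<and>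
    (\<forall>i<n. \<forall>j<n. tangential (grid_vertex P R U V i j) (grid_vertex P R U V (Suc i) j)
                            (grid_vertex P R U V (Suc i) (Suc j)) (grid_vertex P R U V i (Suc j)))"
proof -
  have quad: "convex_quad A B C D" using assms(2) by (simp add: tangential_def)
  obtain e1 e2 u v \<alpha> \<beta> where sq: "projective_square e1 e2 u v \<alpha> \<beta>"
    and X_eq: "projective_square.X A e1 e2 \<alpha> \<beta> 0 0 = A" "projective_square.X A e1 e2 \<alpha> \<beta> 1 0 = B"
    "projective_square.X A e1 e2 \<alpha> \<beta> 1 1 = C" "projective_square.X A e1 e2 \<alpha> \<beta> 0 1 = D"
    using convex_quad_projective_square[OF quad] .
  interpret projective_square A e1 e2 u v \<alpha> \<beta> by (rule sq)
  interpret sw: projective_square A e2 e1 v u \<beta> \<alpha> by (rule swap)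
  have sw_X: "sw.X b a = X a b" for a b
    by (simp add: sw.X_def X_def sw.H_def H_def algebra_simps)
  have sw_w: "sw.w = w" by (simp add: sw.w_def w_def add.commute)
  have sum: "norm u + norm (u - w) = norm v + norm (v - w)"
    by (rule tangential_imp_norm_sum_eq) (use assms(2) X_eq in simp)
  have "0 < n" using assms(1) by simp
  obtain k where "0 < k" and k:
    "\<And>u' w' :: point. \<lbrakk>u' \<noteq> 0; u' \<noteq> w'; norm w' = norm w; norm u' + norm (u' - w') = norm u + norm (u - w)\<rbrakk> \<Longrightarrow>
       \<exists>t :: nat \<Rightarrow> real. t 0 = 0 \<and> t n = 1 \<and> strict_mono_on {..n} t \<and>
         (\<forall>i<n. t (Suc i) - t i = k * (norm (u' - t i *\<^sub>R w') + norm (u' - t (Suc i) *\<^sub>R w')))"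
    using pencil_partition[OF norm_ge_zero norm_w_less[OF sum] \<open>0 < n\<close>, where ?'a = point] by metis
  have uv: "u \<noteq> 0" "u \<noteq> w" "v \<noteq> 0" "v \<noteq> w"
    using normal_nonzero[of 0] normal_nonzero[of 1] sw.normal_nonzero[of 0] sw.normal_nonzero[of 1]
    unfolding sw_w by auto
  obtain s where s: "s 0 = 0" "s n = 1" "strict_mono_on {..n} s"
    and s_step: "\<And>i. i < n \<Longrightarrow> s (Suc i) - s i = k * (norm (u - s i *\<^sub>R w) + norm (u - s (Suc i) *\<^sub>R w))"
    using k[OF uv(1,2) refl refl] by blast
  \<comment> \<open>Equality of the norm sums lets the same \<open>k\<close> subdivide the second
    family; \<open>tangential_cell\<close> requires this common \<open>k\<close>.\<close>
  obtain t where t: "t 0 = 0" "t n = 1" "strict_mono_on {..n} t"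
    and t_step: "\<And>i. i < n \<Longrightarrow> t (Suc i) - t i = k * (norm (v - t i *\<^sub>R w) + norm (v - t (Suc i) *\<^sub>R w))"
    using k[OF uv(3,4) refl sum[symmetric]] by blast
  have less: "s i < s j" "t i < t j" if "i < j" "j \<le> n" for i j
    using s(3) t(3) that by (auto intro: strict_mono_onD)
  have range: "s i \<in> {0..1}" "t i \<in> {0..1}" if "i \<le> n" for i
    using that less[of 0 i] less[of i n] s(1,2) t(1,2) by (cases "i = 0"; cases "i = n"; force)+
  \<comment> \<open>Indices 0 and \<open>n\<close> have parameters 0 and 1, so they give the sides
    of the quadrilateral.\<close>
  define P R U V where "P i = X (s i) 0" and "R i = X (s i) 1"
    and "U i = X 0 (t i)" and "V i = X 1 (t i)" for i
  have int: "closed_segment (P i) (R i) \<inter> closed_segment (U j) (V j) = {X (s i) (t j)}"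
    if "i \<le> n" "j \<le> n" for i j
    unfolding P_def R_def U_def V_def using range that by (intro segment_Int_segment)
  then have vertex: "grid_vertex P R U V i j = X (s i) (t j)" if "i \<le> n" "j \<le> n" for i j
    using that by (simp add: grid_vertex_def)
  have "grid_dissection A B C D n n P R U V"
    unfolding grid_dissection_def
  proof (intro conjI allI impI; (elim conjE)?)
    show "P 0 = A" "R 0 = D" "P n = B" "R n = C" "U 0 = A" "V 0 = B" "U n = D" "V n = C"
      by (simp_all add: P_def R_def U_def V_def s t X_eq)
  next
    fix i assume "i < n"
    then have si: "s i \<in> {0..1}" "t i \<in> {0..1}" using range[of i] by simp_all
    show "P i \<in> closed_segment A B"
      using X_in_segment[of 0 "s i" 1 0] si by (simp add: P_def X_eq)
    show "R i \<in> closed_segment C D"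
      using X_in_segment[of 0 "s i" 1 1] si by (simp add: R_def X_eq closed_segment_commute)
    show "U i \<in> closed_segment A D"
      using X_in_segment'[of 0 "t i" 1 0] si by (simp add: U_def X_eq)
    show "V i \<in> closed_segment B C"
      using X_in_segment'[of 0 "t i" 1 1] si by (simp add: V_def X_eq)
  next
    fix i j assume ij: "i < j" "j < n"
    then show "closed_segment (P i) (R i) \<inter> closed_segment (P j) (R j) = {}"
      unfolding P_def R_def using less range by (intro segments_disjoint) auto
    show "closed_segment (U i) (V i) \<inter> closed_segment (U j) (V j) = {}"
      using sw.segments_disjoint[of "t i" "t j"] less range ij unfolding sw_X U_def V_def by auto
  next
    fix i j assume ij: "i < j" "j \<le> n"
    then show "dist A (P i) < dist A (P j)"
      unfolding P_def using less range by (intro dist_X_less) auto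
    show "dist A (U i) < dist A (U j)"
      using sw.dist_X_less[of "t i" "t j"] less range ij unfolding sw_X U_def by auto
  qed
  moreover have "tangential (grid_vertex P R U V i j) (grid_vertex P R U V (Suc i) j)
      (grid_vertex P R U V (Suc i) (Suc j)) (grid_vertex P R U V i (Suc j))"
    if "i < n" "j < n" for i j
  proof -
    have "tangential (X (s i) (t j)) (X (s (Suc i)) (t j)) (X (s (Suc i)) (t (Suc j))) (X (s i) (t (Suc j)))"
      using that range[of i] range[of j] range[of "Suc i"] range[of "Suc j"] less[of i "Suc i"] less[of j "Suc j"]
      by (intro tangential_cell[OF _ _ _ _ _ _ \<open>0 < k\<close> s_step t_step]) auto
    then show ?thesis using that by (simp add: vertex)
  qed
  ultimately show ?thesis using int by blast
qed

end
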